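(* Let $r>0$. A bounded set $X\subset\mathbb{R}^n$ is resilient to erosion by the radius $r$ if and only if $X$ is a convex body with an inscribed ball of radius $>r$.
   Context: Erosion: for $X\subset\mathbb{R}^n$ and $r>0$, $e_r(X)=X\setminus\bigcup_{y\in X^C}B(r,y)$, where $X^C=\mathbb{R}^n\setminus X$ and $B(r,y)$ is the open ball of radius $r$ about $y$; i.e. $e_r(X)$ is the set of points of $X$ at distance $\ge r$ from $X^C$. The set $X$ is resilient to erosion by the radius $r$ if $e_r(X)=\sigma(X)$ for some Euclidean similarity transformation $\sigma$, i.e. a map $\sigma:\mathbb{R}^n\to\mathbb{R}^n$ for which there is a scaling factor $\alpha>0$ with $|\sigma(x)-\sigma(y)|=\alpha|x-y|$ for all $x,y$. A convex body is a closed convex subset of $\mathbb{R}^n$. A closed half-space $H$ containing the convex body $X$ is a supporting half-space of $X$ at a boundary point $x$ of $X$ if $x$ also lies on the boundary of $H$. A boundary point $x$ of $X$ is regular if it has a unique supporting half-space. A supporting half-space is regular if it is supporting at at least one regular point of $X$. A (regular) supporting hyperplane is the boundary of a (regular) supporting half-space. A closed ball $B$ is inscribed in the convex body $X$ if $B\subset X$ and $B$ intersects all the regular supporting hyperplanes of $X$.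
   Formalization: The set X is additionally assumed to be nonempty, since the empty set is bounded and resilient to erosion but contains no ball of radius > r. *)

theory Defs
  imports "HOL-Analysis.Analysis"
begin

definition erosion :: "real \<Rightarrow> 'a::metric_space set \<Rightarrow> 'a set" where
  "erosion r X = X - (\<Union>y\<in>- X. ball y r)"

definition similarity :: "('a::metric_space \<Rightarrow> 'a) \<Rightarrow> bool" where
  "similarity \<sigma> \<longleftrightarrow> (\<exists>\<alpha>>0. \<forall>x y. dist (\<sigma> x) (\<sigma> y) = \<alpha> * dist x y)"

definition resilient :: "real \<Rightarrow> 'a::metric_space set \<Rightarrow> bool" where
  "resilient r X \<longleftrightarrow> (\<exists>\<sigma>. similarity \<sigma> \<and> erosion r X = \<sigma> ` X)"

definition convex_body :: "'a::euclidean_space set \<Rightarrow> bool" where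
  "convex_body X \<longleftrightarrow> closed X \<and> convex X"

definition closed_halfspace :: "'a::euclidean_space set \<Rightarrow> bool" where
  "closed_halfspace H \<longleftrightarrow> (\<exists>a b. a \<noteq> 0 \<and> H = {x. a \<bullet> x \<le> b})"

definition supporting_halfspace_at ::
    "'a::euclidean_space set \<Rightarrow> 'a set \<Rightarrow> 'a \<Rightarrow> bool" where
  "supporting_halfspace_at X H x \<longleftrightarrow>
     closed_halfspace H \<and> X \<subseteq> H \<and> x \<in> frontier X \<and> x \<in> frontier H"

definition regular_point :: "'a::euclidean_space set \<Rightarrow> 'a \<Rightarrow> bool" where
  "regular_point X x \<longleftrightarrow> x \<in> frontier X \<and> (\<exists>!H. supporting_halfspace_at X H x)"

definition regular_supporting_halfspace ::
    "'a::euclidean_space set \<Rightarrow> 'a set \<Rightarrow> bool" where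
  "regular_supporting_halfspace X H \<longleftrightarrow>
     (\<exists>x. regular_point X x \<and> supporting_halfspace_at X H x)"

definition regular_supporting_hyperplane ::
    "'a::euclidean_space set \<Rightarrow> 'a set \<Rightarrow> bool" where
  "regular_supporting_hyperplane X P \<longleftrightarrow>
     (\<exists>H. regular_supporting_halfspace X H \<and> P = frontier H)"

definition inscribed_ball :: "'a::euclidean_space set \<Rightarrow> 'a \<Rightarrow> real \<Rightarrow> bool" where
  "inscribed_ball X c s \<longleftrightarrow>
     cball c s \<subseteq> X \<and>
     (\<forall>P. regular_supporting_hyperplane X P \<longrightarrow> cball c s \<inter> P \<noteq> {})"

(* The empty set is bounded and resilient but contains no ball, so the
   characterisation of bounded resilient sets concerns nonempty sets. *)
lemma resilient_empty: "resilient r {}"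
proof -
  have "similarity (\<lambda>x. x)"
    unfolding similarity_def by (intro exI[of _ 1]) simp
  then show ?thesis
    unfolding resilient_def erosion_def by auto
qed

end

theory Submission
  imports Defs
begin

text \<open>
  Suppose first that \<open>X\<close> is a convex body with inscribed ball of centre \<open>c\<close> and radius \<open>s > r\<close>.
  Each regular supporting half-space of \<open>X\<close> then has the form \<open>v \<bullet> (x - c) \<le> s\<close> with a unit
  vector \<open>v\<close>, and \<open>X\<close> is the intersection of these half-spaces (\<open>inscribed_ball_separation\<close>).
  A ball of radius \<open>r\<close> lies in such a half-space iff its centre \<open>x\<close> satisfies
  \<open>v \<bullet> (x - c) \<le> s - r\<close>, so erosion is the homothety about \<open>c\<close> with ratio \<open>(s - r) / s\<close>
  (\<open>erosion_inscribed_ball\<close>).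

  Conversely, let \<open>\<sigma>\<close> be a similarity of ratio \<open>\<alpha>\<close> that maps \<open>X\<close> onto its erosion. Erosion
  shortens the diameter, so \<open>\<alpha> < 1\<close> and \<open>\<sigma>\<close> has a fixed point, which serves as the origin; there
  \<open>\<sigma> = \<alpha> L\<close> with \<open>L\<close> orthogonal. Radii add up under successive erosions, so \<open>\<sigma>\<close> applied \<open>k\<close>
  times gives the erosion by \<open>R (1 - \<alpha>^k)\<close>, where \<open>R = r / (1 - \<alpha>)\<close> (\<open>erosion_iterate\<close>). In
  particular \<open>X\<close> contains the closed ball of radius \<open>R > r\<close> about the origin. If \<open>z \<notin> X\<close>, then
  the ball of radius \<open>R (1 - \<alpha>^k)\<close> about the point \<open>\<alpha>^k L^k z\<close>, which tends to the origin, contains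
  some \<open>Y\<^sub>k \<notin> X\<close>, whereas for \<open>x \<in> X\<close> the corresponding ball lies in \<open>X\<close>. To first order in \<open>\<alpha>^k\<close> the
  comparison of these distances is linear in \<open>x\<close> and \<open>z\<close>: a limit \<open>u\<close> of the vectors
  \<open>L^(-k) Y\<^sub>k\<close> has norm \<open>R\<close> and satisfies \<open>u \<bullet> x \<le> u \<bullet> z\<close> on \<open>X\<close> and \<open>u \<bullet> z \<ge> R\<^sup>2\<close>
  (\<open>exterior_limit\<close>). The first inequality makes \<open>X\<close> convex (\<open>convex_X\<close>).

  Once \<open>X\<close> is convex, a limit \<open>y\<close> of the \<open>Y\<^sub>k\<close> is a point where the ball of radius \<open>R\<close> touches the
  boundary of \<open>X\<close>, so \<open>y \<bullet> x \<le> R\<^sup>2\<close> is a supporting half-space. The set of such points is closed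
  and invariant under the inverse of \<open>L\<close>, and \<open>L^(-k) y\<close> is close to \<open>L^(-k) Y\<^sub>k\<close>; hence \<open>u\<close> is
  such a point too (\<open>exterior_normal\<close>). When \<open>z\<close> tends to a boundary point \<open>q\<close>, this gives a
  supporting half-space at \<open>q\<close> that touches the ball. At a regular \<open>q\<close> it is the only one, so the
  ball is inscribed.
\<close>

section \<open>Supporting half-spaces and touching balls\<close>

lemma erosion_eq: "r > 0 \<Longrightarrow> erosion r X = {x. ball x r \<subseteq> X}"
  unfolding erosion_def by (auto simp: dist_commute subset_iff)

text \<open>
  The furthest point of the ball in direction \<open>a\<close> shows that the Cauchy-Schwarz inequality for \<open>a\<close>
  and \<open>q - p\<close> is an equality.
\<close>

lemma normal_at_touching_ball:
  fixes a p q :: "'a::euclidean_space"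
  assumes "cball p \<rho> \<subseteq> {x. a \<bullet> x \<le> a \<bullet> q}" "norm (q - p) = \<rho>" "a \<noteq> 0" "\<rho> > 0"
  shows "a = (norm a / \<rho>) *\<^sub>R (q - p)"
proof -
  let ?m = "p + (\<rho> / norm a) *\<^sub>R a"
  have "?m \<in> cball p \<rho>"
    using assms by (simp add: dist_norm)
  then have "a \<bullet> ?m \<le> a \<bullet> q"
    using assms(1) by blast
  then have "norm a * \<rho> \<le> a \<bullet> (q - p)"
    using assms by (simp add: inner_simps power2_norm_eq_inner[symmetric] power2_eq_square mult.commute)
  then have "a \<bullet> (q - p) = norm a * norm (q - p)"
    using norm_cauchy_schwarz[of a "q - p"] assms by simp
  then have "norm a *\<^sub>R (q - p) = \<rho> *\<^sub>R a"
    using assms norm_cauchy_schwarz_eq by metis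
  then have "(1 / \<rho>) *\<^sub>R (norm a *\<^sub>R (q - p)) = (1 / \<rho>) *\<^sub>R (\<rho> *\<^sub>R a)"
    by simp
  then show ?thesis
    using assms by simp
qed

text \<open>
  A half-space that supports \<open>X\<close> at \<open>q\<close> contains the ball and has \<open>q\<close> on its boundary, so its
  normal is radial. A ball in \<open>X\<close> that touches the boundary thus always produces a regular point.
\<close>

lemma regular_point_touching_ball:
  fixes X :: "'a::euclidean_space set"
  assumes "convex X" "closed X" and sub: "cball p \<rho> \<subseteq> X" and q: "q \<in> frontier X"
    and d: "norm (q - p) = \<rho>" and "\<rho> > 0"
  shows "supporting_halfspace_at X {x. (q - p) \<bullet> x \<le> (q - p) \<bullet> q} q" "regular_point X q"
proof -
  let ?H = "{x. (q - p) \<bullet> x \<le> (q - p) \<bullet> q}"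
  have uniq: "H = ?H" if "supporting_halfspace_at X H q" for H
  proof -
    have "closed_halfspace H"
      using that unfolding supporting_halfspace_at_def by simp
    then obtain a b where a: "a \<noteq> 0" "H = {x. a \<bullet> x \<le> b}"
      unfolding closed_halfspace_def by metis
    then have b: "b = a \<bullet> q"
      using that unfolding supporting_halfspace_at_def by (simp add: frontier_halfspace_le)
    have "X \<subseteq> {x. a \<bullet> x \<le> a \<bullet> q}"
      using that unfolding supporting_halfspace_at_def a(2) b by simp
    with sub have "cball p \<rho> \<subseteq> {x. a \<bullet> x \<le> a \<bullet> q}"
      by (rule subset_trans)
    note normal = normal_at_touching_ball[OF this d a(1) \<open>\<rho> > 0\<close>]
    have *: "a \<bullet> x = (norm a / \<rho>) * ((q - p) \<bullet> x)" for x
      using arg_cong[OF normal, of "\<lambda>t. t \<bullet> x"] by (simp only: inner_scaleR_left)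
    have "norm a / \<rho> > 0"
      using a(1) \<open>\<rho> > 0\<close> by simp
    then have "a \<bullet> x \<le> a \<bullet> q \<longleftrightarrow> (q - p) \<bullet> x \<le> (q - p) \<bullet> q" for x
      unfolding *[of x] *[of q] by (rule mult_le_cancel_left_pos)
    then show ?thesis
      unfolding a(2) b by (rule Collect_cong)
  qed
  have "q \<in> closure X" "q \<notin> interior X"
    using q by (auto simp: frontier_def)
  moreover have "rel_interior X = interior X"
  proof (rule rel_interior_nonempty_interior)
    have "p \<in> interior X"
      using sub \<open>\<rho> > 0\<close> mem_interior_cball by blast
    then show "interior X \<noteq> {}" by blast
  qed
  ultimately have "q \<in> closure X" "q \<notin> rel_interior X"
    by simp_all
  then obtain a where a: "a \<noteq> 0" "\<And>y. y \<in> closure X \<Longrightarrow> a \<bullet> q \<le> a \<bullet> y"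
    by (rule supporting_hyperplane_relative_frontier[OF \<open>convex X\<close>]) (rule that)
  have "closed_halfspace {x. (- a) \<bullet> x \<le> (- a) \<bullet> q}"
    unfolding closed_halfspace_def using a(1)
    by (intro exI[of _ "- a"] exI[of _ "(- a) \<bullet> q"]) simp
  moreover have "X \<subseteq> {x. (- a) \<bullet> x \<le> (- a) \<bullet> q}"
    using a(2) closure_subset[of X] by auto
  moreover have "q \<in> frontier {x. (- a) \<bullet> x \<le> (- a) \<bullet> q}"
    using a(1) by (subst frontier_halfspace_le) auto
  ultimately have sup: "supporting_halfspace_at X {x. (- a) \<bullet> x \<le> (- a) \<bullet> q} q"
    unfolding supporting_halfspace_at_def using q by simp
  then show H: "supporting_halfspace_at X ?H q"
    using uniq[OF sup] by simp
  show "regular_point X q"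
    unfolding regular_point_def
    by (rule conjI[OF q], rule ex1I[of _ ?H], rule H, erule uniq)
qed

section \<open>Eroding a body with an inscribed ball\<close>

lemma cball_subset_to_nearest_frontier_point:
  fixes X :: "'a::euclidean_space set"
  assumes "closed X" "p \<in> X" "\<And>y. y \<in> frontier X \<Longrightarrow> \<rho> \<le> dist p y" "\<rho> > 0"
  shows "cball p \<rho> \<subseteq> X"
proof -
  have "ball p \<rho> \<subseteq> X"
  proof (rule ccontr)
    assume "\<not> ball p \<rho> \<subseteq> X"
    then have "ball p \<rho> - X \<noteq> {}"
      by simp
    moreover have "ball p \<rho> \<inter> X \<noteq> {}"
      using assms centre_in_ball by fastforce
    ultimately have "ball p \<rho> \<inter> frontier X \<noteq> {}"
      using connected_Int_frontier[OF connected_ball] by metis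
    then show False
      using assms(3) by fastforce
  qed
  then have "closure (ball p \<rho>) \<subseteq> X"
    using \<open>closed X\<close> by (rule closure_minimal)
  then show ?thesis
    using \<open>\<rho> > 0\<close> by simp
qed

text \<open>
  The segment from \<open>c\<close> to \<open>z\<close> leaves \<open>X\<close> at a boundary point \<open>w\<close>, which itself need not be
  regular. From an interior point \<open>p\<close> of the segment near \<open>w\<close>, however, the nearest boundary point
  \<open>q\<close> is touched by a ball about \<open>p\<close> and is regular. Its supporting half-space is tangent to the
  inscribed ball, and because \<open>q\<close> is near \<open>w\<close>, it excludes \<open>z\<close>.
\<close>

lemma inscribed_ball_separation:
  fixes X :: "'a::euclidean_space set"
  assumes "convex X" "closed X" and ins: "inscribed_ball X c s" and "s > 0" and z: "z \<notin> X"
  obtains v where "norm v = 1" "\<And>x. x \<in> X \<Longrightarrow> v \<bullet> (x - c) \<le> s" "s < v \<bullet> (z - c)"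
proof -
  have cb: "cball c s \<subseteq> X"
    and touch: "\<And>P. regular_supporting_hyperplane X P \<Longrightarrow> cball c s \<inter> P \<noteq> {}"
    using ins unfolding inscribed_ball_def by auto
  have cX: "c \<in> X"
    using cb \<open>s > 0\<close> by auto
  have cint: "c \<in> interior X"
    using cb \<open>s > 0\<close> mem_interior_cball by blast
  have "closed_segment c z \<inter> frontier X \<noteq> {}"
    using cX z by (intro connected_Int_frontier) auto
  then obtain w where w: "w \<in> closed_segment c z" "w \<in> frontier X"
    by blast
  then obtain t where t: "0 \<le> t" "t \<le> 1" and wt: "w - c = t *\<^sub>R (z - c)"
    by (auto simp: closed_segment_def algebra_simps)
  have wX: "w \<in> X"
    using w(2) \<open>closed X\<close> frontier_subset_closed by blast
  have "w \<notin> interior X"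
    using w(2) by (auto simp: frontier_def)
  then have "t \<noteq> 0"
    using wt cint by auto
  moreover have "t \<noteq> 1"
    using wt wX z by auto
  ultimately have t: "0 < t" "t < 1"
    using t by auto
  define D where "D = norm (z - c)"
  \<comment> \<open>The ratio by which \<open>p\<close> is drawn back from \<open>w\<close> towards \<open>c\<close>:
      the distance from \<open>w\<close> to \<open>q\<close> will be at most \<open>2 e t D\<close>, and \<open>2 e D < (1 - t) s\<close> keeps \<open>z\<close> beyond
      the supporting hyperplane at \<open>q\<close>.\<close>
  define e where "e = (1 - t) * (s / (4 * (D + s)))"
  have D: "D \<ge> 0"
    unfolding D_def by simp
  have e0: "e > 0"
    unfolding e_def using t D \<open>s > 0\<close> by simp
  have "s / (4 * (D + s)) \<le> 1"
    using D \<open>s > 0\<close> by (simp add: divide_simps)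
  then have e1: "e \<le> 1"
    unfolding e_def using t D \<open>s > 0\<close> mult_mono[of "1 - t" 1 "s / (4 * (D + s))" 1] by simp
  have "4 * e * D \<le> (1 - t) * s"
  proof -
    have "4 * e * D = (1 - t) * s * (D / (D + s))"
      unfolding e_def using D \<open>s > 0\<close> by (simp add: field_simps)
    also have "\<dots> \<le> (1 - t) * s * 1"
      using t D \<open>s > 0\<close> by (intro mult_left_mono) (auto simp: divide_simps)
    finally show ?thesis by simp
  qed
  moreover have "(1 - t) * s > 0"
    using t \<open>s > 0\<close> by simp
  ultimately have e2: "2 * e * D < (1 - t) * s"
    by linarith
  define p where "p = w - e *\<^sub>R (w - c)"
  have p: "p \<in> interior X"
    unfolding p_def using mem_interior_convex_shrink[OF \<open>convex X\<close> cint wX] e0 e1 by simp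
  obtain q where q: "q \<in> frontier X" "\<And>y. y \<in> frontier X \<Longrightarrow> dist p q \<le> dist p y"
    using distance_attains_inf[of "frontier X" p] w(2) by auto
  define \<rho> where "\<rho> = dist p q"
  have "p \<noteq> q"
    using p q(1) by (auto simp: frontier_def)
  then have \<rho>: "\<rho> > 0"
    unfolding \<rho>_def by simp
  have "cball p \<rho> \<subseteq> X"
    using \<open>closed X\<close> p interior_subset q(2) \<rho> unfolding \<rho>_def
    by (intro cball_subset_to_nearest_frontier_point) auto
  moreover have d: "norm (q - p) = \<rho>"
    unfolding \<rho>_def by (simp add: dist_norm norm_minus_commute)
  ultimately have reg: "supporting_halfspace_at X {x. (q - p) \<bullet> x \<le> (q - p) \<bullet> q} q" "regular_point X q"
    using regular_point_touching_ball[OF \<open>convex X\<close> \<open>closed X\<close> _ q(1)] \<rho> by blast+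
  define v where "v = (1 / \<rho>) *\<^sub>R (q - p)"
  have v1: "norm v = 1"
    unfolding v_def using d \<rho> by simp
  have inner_v: "(q - p) \<bullet> x = \<rho> * (v \<bullet> x)" for x
    unfolding v_def using \<rho> by simp
  have H: "{x. (q - p) \<bullet> x \<le> (q - p) \<bullet> q} = {x. v \<bullet> x \<le> v \<bullet> q}"
    using \<rho> by (simp add: inner_v)
  have v0: "v \<noteq> 0"
    using v1 by auto
  have XH: "v \<bullet> x \<le> v \<bullet> q" if "x \<in> X" for x
    using reg(1) that unfolding H supporting_halfspace_at_def by blast
  have "regular_supporting_hyperplane X {x. v \<bullet> x = v \<bullet> q}"
    unfolding regular_supporting_hyperplane_def regular_supporting_halfspace_def
    using reg unfolding H by (metis frontier_halfspace_le v0)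
  \<comment> \<open>The ball meets the hyperplane and stays on one side of it, so the hyperplane is at distance exactly \<open>s\<close> from \<open>c\<close>.\<close>
  from touch[OF this] obtain m where m: "m \<in> cball c s" "v \<bullet> m = v \<bullet> q"
    by blast
  have "v \<bullet> (m - c) \<le> norm v * norm (m - c)"
    by (rule norm_cauchy_schwarz)
  then have le: "v \<bullet> (q - c) \<le> s"
    using m v1 by (simp add: inner_diff_right dist_norm norm_minus_commute)
  have "c + s *\<^sub>R v \<in> cball c s"
    using v1 \<open>s > 0\<close> by (simp add: dist_norm)
  then have "v \<bullet> (c + s *\<^sub>R v) \<le> v \<bullet> q"
    using cb XH by blast
  then have "s \<le> v \<bullet> (q - c)"
    using v1 by (simp add: inner_simps power2_norm_eq_inner[symmetric])
  with le have vq: "v \<bullet> (q - c) = s"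
    by simp
  have "v \<bullet> (q - w) \<le> norm v * norm (q - w)"
    by (rule norm_cauchy_schwarz)
  also have "\<dots> \<le> dist p q + dist p w"
    using v1 dist_triangle3[of q w p] by (simp add: dist_norm)
  also have "\<dots> \<le> 2 * dist p w"
    using q(2)[OF w(2)] by simp
  also have "dist p w = e * (t * D)"
    unfolding p_def dist_norm wt D_def using e0 t by simp
  finally have "v \<bullet> (q - w) \<le> t * (2 * e * D)"
    by (simp add: mult_ac)
  also have "\<dots> < t * ((1 - t) * s)"
    using e2 t by simp
  finally have "v \<bullet> (q - w) < t * ((1 - t) * s)" .
  moreover have "v \<bullet> (q - w) = s - t * (v \<bullet> (z - c))"
  proof -
    have "q - w = (q - c) - t *\<^sub>R (z - c)"
      using wt by (simp add: algebra_simps)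
    then show ?thesis
      unfolding \<open>q - w = _\<close> inner_diff_right[of v "q - c"] vq by simp
  qed
  moreover have "t * ((1 - t) * s) \<le> (1 - t) * s"
    using t \<open>s > 0\<close> by (simp add: mult_left_le_one_le)
  ultimately have "t * s < t * (v \<bullet> (z - c))"
    by (simp add: algebra_simps)
  then have "s < v \<bullet> (z - c)"
    using t by simp
  moreover have "v \<bullet> (x - c) \<le> s" if "x \<in> X" for x
    using XH[OF that] vq by (simp add: inner_diff_right)
  ultimately show thesis
    using that v1 by blast
qed

text \<open>
  Convexity puts the image of \<open>X\<close> inside the erosion: the ball of radius \<open>r\<close> about the image of
  \<open>x\<close> is a convex combination of \<open>x\<close> and the inscribed ball. The other inclusion is the shift of
  each regular supporting half-space by \<open>r\<close>.
\<close>

lemma erosion_inscribed_ball: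
  fixes X :: "'a::euclidean_space set"
  assumes "convex X" "closed X" and ins: "inscribed_ball X c s" and "0 < r" "r < s"
  shows "erosion r X = (\<lambda>x. c + ((s - r) / s) *\<^sub>R (x - c)) ` X"
proof -
  define l where "l = (s - r) / s"
  have s: "s > 0"
    using assms by simp
  have l: "0 < l" "l < 1" "1 - l = r / s"
    unfolding l_def using assms by (auto simp: field_simps)
  have cb: "cball c s \<subseteq> X"
    using ins unfolding inscribed_ball_def by simp
  have "ball (c + l *\<^sub>R (x - c)) r \<subseteq> X" if "x \<in> X" for x
  proof
    fix y assume y: "y \<in> ball (c + l *\<^sub>R (x - c)) r"
    define b where "b = (s / r) *\<^sub>R (y - (c + l *\<^sub>R (x - c)))"
    have "norm b = (s / r) * norm (y - (c + l *\<^sub>R (x - c)))"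
      unfolding b_def using s assms by simp
    also have "\<dots> \<le> (s / r) * r"
      using y s assms by (intro mult_left_mono) (auto simp: dist_norm norm_minus_commute)
    finally have "c + b \<in> cball c s"
      using assms by (simp add: dist_norm)
    then have "c + b \<in> X"
      using cb by blast
    moreover have "y = l *\<^sub>R x + (1 - l) *\<^sub>R (c + b)"
    proof -
      have "(1 - l) *\<^sub>R b = y - (c + l *\<^sub>R (x - c))"
        unfolding b_def l(3) using s assms by simp
      then show ?thesis
        by (simp add: algebra_simps)
    qed
    ultimately show "y \<in> X"
      using \<open>convex X\<close> that l by (auto intro!: convexD)
  qed
  moreover have "y \<in> (\<lambda>x. c + l *\<^sub>R (x - c)) ` X" if y: "ball y r \<subseteq> X" for y
  proof -
    define x where "x = c + (1 / l) *\<^sub>R (y - c)"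
    have yx: "y = c + l *\<^sub>R (x - c)"
      unfolding x_def using l by simp
    have "x \<in> X"
    proof (rule ccontr)
      assume "x \<notin> X"
      then obtain v where v: "norm v = 1" "\<And>x. x \<in> X \<Longrightarrow> v \<bullet> (x - c) \<le> s" "s < v \<bullet> (x - c)"
        using inscribed_ball_separation[OF assms(1-3) s] by metis
      have "closure (ball y r) \<subseteq> X"
        using y \<open>closed X\<close> by (rule closure_minimal)
      then have "y + r *\<^sub>R v \<in> X"
        using v(1) \<open>0 < r\<close> by (auto simp: dist_norm subset_iff)
      then have "v \<bullet> (y + r *\<^sub>R v - c) \<le> s"
        using v(2) by blast
      moreover have "v \<bullet> (y + r *\<^sub>R v - c) = l * (v \<bullet> (x - c)) + r"
      proof -
        have "y + r *\<^sub>R v - c = l *\<^sub>R (x - c) + r *\<^sub>R v"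
          using yx by simp
        moreover have "v \<bullet> v = 1"
          using v(1) by (simp flip: power2_norm_eq_inner)
        ultimately show ?thesis
          by (simp only: inner_add_right inner_scaleR_right)
      qed
      moreover have "l * s = s - r"
        unfolding l_def using s by simp
      moreover have "l * s < l * (v \<bullet> (x - c))"
        using l v(3) by simp
      ultimately show False
        by linarith
    qed
    then show ?thesis
      using yx by blast
  qed
  ultimately show ?thesis
    unfolding erosion_eq[OF \<open>0 < r\<close>] l_def[symmetric] by blast
qed

lemma resilient_if_inscribed_ball:
  fixes X :: "'a::euclidean_space set"
  assumes "convex_body X" "inscribed_ball X c s" "0 < r" "r < s"
  shows "resilient r X"
proof -
  define \<sigma> :: "'a \<Rightarrow> 'a" where "\<sigma> x = c + ((s - r) / s) *\<^sub>R (x - c)" for x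
  have "dist (\<sigma> x) (\<sigma> y) = (s - r) / s * dist x y" for x y
  proof -
    have "\<sigma> x - \<sigma> y = ((s - r) / s) *\<^sub>R (x - y)"
      unfolding \<sigma>_def by (simp add: algebra_simps)
    then show ?thesis
      using assms by (simp add: dist_norm)
  qed
  moreover have "(s - r) / s > 0"
    using assms by simp
  ultimately have "similarity \<sigma>"
    unfolding similarity_def by blast
  moreover have "erosion r X = \<sigma> ` X"
    using erosion_inscribed_ball[of X c s r] assms unfolding convex_body_def \<sigma>_def by simp
  ultimately show ?thesis
    unfolding resilient_def by blast
qed

section \<open>The fixed centre of a resilient set\<close>

text \<open>
  The erosion is always closed, and \<open>X\<close> is its preimage under the continuous injection \<open>\<sigma>\<close>.
\<close>

lemma resilient_closed:
  fixes X :: "'a::euclidean_space set"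
  assumes "similarity \<sigma>" "erosion r X = \<sigma> ` X" "r > 0"
  shows "closed X"
proof -
  obtain \<alpha> where \<alpha>: "\<alpha> > 0" "\<And>x y. dist (\<sigma> x) (\<sigma> y) = \<alpha> * dist x y"
    using assms(1) unfolding similarity_def by blast
  have "inj \<sigma>"
    by (rule injI) (metis \<alpha> dist_eq_0_iff mult_eq_0_iff less_irrefl)
  then have "X = \<sigma> -` erosion r X"
    unfolding assms(2) by (simp add: inj_vimage_image_eq)
  moreover have "erosion r X = - (\<Union>y\<in>- X. ball y r)"
    unfolding erosion_def using \<open>r > 0\<close> by force
  then have "closed (erosion r X)"
    by (auto intro: open_UN simp: closed_def)
  moreover have "continuous_on UNIV \<sigma>"
  proof (rule uniformly_continuous_imp_continuous, rule lipschitz_on_uniformly_continuous)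
    show "\<alpha>-lipschitz_on UNIV \<sigma>"
      using \<alpha> by (auto intro: lipschitz_onI)
  qed
  ultimately show ?thesis
    using closed_vimage[of "erosion r X" \<sigma>] by simp
qed

text \<open>
  Prolong the segment from \<open>p\<close> to \<open>q\<close> by \<open>s\<close> beyond \<open>q\<close>.
\<close>

lemma dist_add_radius_le_diameter:
  fixes X :: "'a::euclidean_space set"
  assumes "bounded X" "ball p r \<subseteq> X" "ball q r \<subseteq> X" "0 < s" "s < r"
  shows "dist p q + s \<le> diameter X"
proof -
  obtain v where v: "norm v = 1" "q - p = dist p q *\<^sub>R v"
  proof (cases "p = q")
    case True
    then show ?thesis
      using that vector_choose_size[of 1] by (metis diff_self dist_self scaleR_zero_left zero_le_one)
  next
    case False
    then show ?thesis
      by (intro that[of "(1 / dist p q) *\<^sub>R (q - p)"]) (auto simp: dist_norm norm_minus_commute)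
  qed
  have "p \<in> X" "q + s *\<^sub>R v \<in> X"
    using assms v by (auto simp: dist_norm subset_iff)
  then have "dist p (q + s *\<^sub>R v) \<le> diameter X"
    using \<open>bounded X\<close> by (intro diameter_bounded_bound)
  moreover have "(q + s *\<^sub>R v) - p = (dist p q + s) *\<^sub>R v"
    using v(2) by (simp add: algebra_simps)
  then have "dist p (q + s *\<^sub>R v) = dist p q + s"
    using v(1) \<open>0 < s\<close> by (simp add: dist_norm[of p] norm_minus_commute[of p])
  ultimately show ?thesis by simp
qed

text \<open>
  The points \<open>\<sigma> x\<close> and \<open>\<sigma> y\<close> are centres of balls of radius \<open>r\<close> in \<open>X\<close>, which bounds their
  distance away from the diameter of \<open>X\<close>.
\<close>

lemma resilient_ratio_less_1:
  fixes X :: "'a::euclidean_space set"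
  assumes "bounded X" "X \<noteq> {}" "r > 0" "\<alpha> > 0"
    and \<sigma>: "\<And>x y. dist (\<sigma> x) (\<sigma> y) = \<alpha> * dist x y" and e: "erosion r X = \<sigma> ` X"
  shows "\<alpha> < 1"
proof -
  have b: "ball (\<sigma> x) r \<subseteq> X" if "x \<in> X" for x
    using e that unfolding erosion_eq[OF \<open>r > 0\<close>] by blast
  have *: "\<alpha> * dist x y + r / 2 \<le> diameter X" if "x \<in> X" "y \<in> X" for x y
    using dist_add_radius_le_diameter[OF \<open>bounded X\<close> b[OF that(1)] b[OF that(2)], of "r / 2"]
      \<open>r > 0\<close> \<sigma> by simp
  have "diameter X \<le> (diameter X - r / 2) / \<alpha>"
  proof (rule diameter_le)
    fix x y assume "x \<in> X" "y \<in> X"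
    then show "norm (x - y) \<le> (diameter X - r / 2) / \<alpha>"
      using *[of x y] \<open>\<alpha> > 0\<close> by (simp add: dist_norm field_simps)
  qed (use \<open>X \<noteq> {}\<close> in blast)
  then have "\<alpha> * diameter X < diameter X"
    using \<open>\<alpha> > 0\<close> \<open>r > 0\<close> by (simp add: field_simps)
  moreover have "0 \<le> diameter X"
    using \<open>bounded X\<close> by (rule diameter_ge_0)
  ultimately show ?thesis
    by (metis mult_le_cancel_right1 not_less)
qed

section \<open>Iterating the erosion\<close>

text \<open>
  A resilient set, with the fixed point of its similarity moved to the origin and the similarity
  written as \<open>\<alpha>\<close> times the orthogonal map \<open>L\<close>. Since that map is a bijection, \<open>erosion_iff\<close> states
  that it carries \<open>X\<close> onto the erosion of \<open>X\<close> by \<open>r\<close>.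
\<close>

locale self_eroding =
  fixes X :: "'a::euclidean_space set" and \<alpha> r :: real and L :: "'a \<Rightarrow> 'a"
  assumes closed_X: "closed X" and nonempty: "X \<noteq> {}"
    and \<alpha>_pos: "0 < \<alpha>" and \<alpha>_less_1: "\<alpha> < 1" and r_pos: "0 < r"
    and orth: "orthogonal_transformation L"
    and erosion_iff: "\<And>x. x \<in> X \<longleftrightarrow> ball (\<alpha> *\<^sub>R L x) r \<subseteq> X"
begin

text \<open>
  The sum of the radii \<open>r\<close>, \<open>\<alpha> r\<close>, \<open>\<alpha>\<^sup>2 r\<close>, ... of all successive erosions; it turns out to be
  the radius of the inscribed ball.
\<close>

definition R :: real where "R = r / (1 - \<alpha>)"

text \<open>
  Since \<open>L\<close> is orthogonal, this is also its adjoint: its powers carry the inner product of \<open>Y\<close> with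
  \<open>L^k x\<close> over to one with \<open>x\<close> itself, so that limits in \<open>k\<close> can be taken with \<open>x\<close> fixed.
\<close>

definition M :: "'a \<Rightarrow> 'a" where "M = inv L"

lemma R_fixed: "r + \<alpha> * R = R"
  unfolding R_def using \<alpha>_less_1 by (simp add: field_simps)

lemma r_less_R: "r < R"
  using R_fixed \<alpha>_pos r_pos \<alpha>_less_1 unfolding R_def by (simp add: field_simps)

lemma R_pos: "R > 0"
  using r_less_R r_pos by simp

lemma dist_scaled_L: "dist (\<alpha> *\<^sub>R L x) (\<alpha> *\<^sub>R L y) = \<alpha> * dist x y"
proof -
  have "dist (L x) (L y) = dist x y"
    using orth by (simp add: orthogonal_transformation_isometry)
  then show ?thesis
    using \<alpha>_pos by (simp add: dist_norm flip: scaleR_diff_right)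
qed

lemma L_M: "L (M x) = x"
  unfolding M_def using orthogonal_transformation_surj[OF orth] by (rule surj_f_inv_f)

lemma inner_M_funpow: "(M ^^ k) y \<bullet> x = y \<bullet> (L ^^ k) x"
proof (induction k arbitrary: x)
  case (Suc k)
  have "M a \<bullet> x = a \<bullet> L x" for a
    using orth L_M unfolding orthogonal_transformation_def by metis
  then show ?case
    using Suc by (simp add: funpow_swap1[of L])
qed simp

lemma norm_M_funpow: "norm ((M ^^ k) y) = norm y"
proof (induction k)
  case (Suc k)
  have "norm (M a) = norm a" for a
    unfolding M_def using orth orthogonal_transformation_inv orthogonal_transformation_norm by metis
  then show ?case
    using Suc by simp
qed simp

lemma norm_L_funpow: "norm ((L ^^ k) y) = norm y"
  by (induction k) (simp_all add: orthogonal_transformation_norm[OF orth])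

lemma M_funpow_diff: "(M ^^ k) (x - y) = (M ^^ k) x - (M ^^ k) y"
proof (induction k)
  case (Suc k)
  have "linear M"
    unfolding M_def using orth orthogonal_transformation_inv orthogonal_transformation_linear by blast
  then show ?case
    using Suc by (simp add: linear_diff)
qed simp

text \<open>
  The ball of radius \<open>r + \<alpha> \<rho>\<close> about \<open>\<alpha> L w\<close> is the union of the balls of radius \<open>r\<close> about the points
  \<open>\<alpha> L v\<close>, where \<open>v\<close> runs through the ball of radius \<open>\<rho>\<close> about \<open>w\<close>.
\<close>

lemma ball_step:
  assumes "\<rho> > 0"
  shows "ball (\<alpha> *\<^sub>R L w) (r + \<alpha> * \<rho>) \<subseteq> X \<longleftrightarrow> ball w \<rho> \<subseteq> X"
proof
  assume sub: "ball (\<alpha> *\<^sub>R L w) (r + \<alpha> * \<rho>) \<subseteq> X"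
  show "ball w \<rho> \<subseteq> X"
  proof
    fix v assume "v \<in> ball w \<rho>"
    then have "dist (\<alpha> *\<^sub>R L w) (\<alpha> *\<^sub>R L v) < \<alpha> * \<rho>"
      using \<alpha>_pos by (simp add: dist_scaled_L)
    then have "ball (\<alpha> *\<^sub>R L v) r \<subseteq> ball (\<alpha> *\<^sub>R L w) (r + \<alpha> * \<rho>)"
      by (simp add: ball_subset_ball_iff dist_commute)
    with sub show "v \<in> X"
      unfolding erosion_iff[of v] by blast
  qed
next
  assume sub: "ball w \<rho> \<subseteq> X"
  show "ball (\<alpha> *\<^sub>R L w) (r + \<alpha> * \<rho>) \<subseteq> X"
  proof
    fix x assume x: "x \<in> ball (\<alpha> *\<^sub>R L w) (r + \<alpha> * \<rho>)"
    define p where "p = \<alpha> *\<^sub>R L w"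
    define T where "T = r + \<alpha> * \<rho>"
    have T: "T > 0"
      unfolding T_def using r_pos \<alpha>_pos \<open>\<rho> > 0\<close> by (simp add: add_pos_pos)
    have d: "norm (x - p) < T"
      using x unfolding p_def T_def by (simp add: dist_norm norm_minus_commute)
    \<comment> \<open>The point that splits the segment from \<open>p\<close> to \<open>x\<close> in the proportion of \<open>\<alpha> \<rho>\<close> to \<open>r\<close>.\<close>
    define q where "q = p + (\<alpha> * \<rho> / T) *\<^sub>R (x - p)"
    define v where "v = M ((1 / \<alpha>) *\<^sub>R q)"
    have q: "q = \<alpha> *\<^sub>R L v"
      unfolding v_def L_M using \<alpha>_pos by simp
    have "norm (q - p) = (\<alpha> * \<rho> / T) * norm (x - p)"
      unfolding q_def using \<alpha>_pos \<open>\<rho> > 0\<close> T by simp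
    also have "\<dots> < (\<alpha> * \<rho> / T) * T"
      using d \<alpha>_pos \<open>\<rho> > 0\<close> T by (intro mult_strict_left_mono) auto
    finally have "\<alpha> * dist w v < \<alpha> * \<rho>"
      using T unfolding dist_scaled_L[symmetric] p_def[symmetric] q[symmetric]
      by (simp add: dist_norm norm_minus_commute)
    then have "v \<in> ball w \<rho>"
      using \<alpha>_pos by simp
    then have "ball q r \<subseteq> X"
      using sub erosion_iff[of v] q by auto
    have "r / T = 1 - \<alpha> * \<rho> / T"
      using T unfolding T_def by (simp add: field_simps)
    then have "x - q = (r / T) *\<^sub>R (x - p)"
      unfolding q_def \<open>r / T = _\<close> by (simp add: algebra_simps)
    then have "norm (x - q) = (r / T) * norm (x - p)"
      using r_pos T by simp
    moreover have "(r / T) * norm (x - p) < (r / T) * T"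
      using d r_pos T by (intro mult_strict_left_mono) auto
    ultimately have "x \<in> ball q r"
      using T by (simp add: dist_norm norm_minus_commute)
    with \<open>ball q r \<subseteq> X\<close> show "x \<in> X"
      by blast
  qed
qed

text \<open>
  The radii \<open>\<rho>\<^sub>k = R (1 - \<alpha>^k)\<close> satisfy \<open>\<rho>\<^sub>1 = r\<close> and \<open>\<rho>\<^sub>k\<^sub>+\<^sub>1 = r + \<alpha> \<rho>\<^sub>k\<close>. For \<open>k = 0\<close> the open
  ball is empty and says nothing about \<open>x\<close>.
\<close>

lemma erosion_iterate:
  assumes "k > 0"
  shows "x \<in> X \<longleftrightarrow> ball (\<alpha> ^ k *\<^sub>R (L ^^ k) x) (R * (1 - \<alpha> ^ k)) \<subseteq> X"
  using assms
proof (induction k rule: nat_induct_non_zero)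
  case 1
  have "R * (1 - \<alpha>) = r"
    using R_fixed by (simp add: algebra_simps)
  then show ?case
    by (simp flip: erosion_iff)
next
  case (Suc k)
  have "\<alpha> ^ k < 1"
    using \<alpha>_pos \<alpha>_less_1 Suc by (simp add: power_less_one_iff)
  then have "R * (1 - \<alpha> ^ k) > 0"
    using R_pos by simp
  from ball_step[OF this, of "\<alpha> ^ k *\<^sub>R (L ^^ k) x"]
  have "ball (\<alpha> *\<^sub>R L (\<alpha> ^ k *\<^sub>R (L ^^ k) x)) (r + \<alpha> * (R * (1 - \<alpha> ^ k))) \<subseteq> X \<longleftrightarrow> x \<in> X"
    using Suc by simp
  moreover have "r + \<alpha> * (R * (1 - \<alpha> ^ k)) = R * (1 - \<alpha> ^ Suc k)"
    using R_fixed by (simp add: algebra_simps)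
  ultimately show ?case
    by (simp add: orthogonal_transformation_scaleR[OF orth])
qed

text \<open>
  The orbit of any point of \<open>X\<close> stays in \<open>X\<close> and tends to the origin.
\<close>

lemma zero_in_X: "0 \<in> X"
proof -
  obtain x where x: "x \<in> X"
    using nonempty by blast
  have mem: "\<alpha> ^ Suc k *\<^sub>R (L ^^ Suc k) x \<in> X" for k
  proof -
    have "\<alpha> ^ Suc k < 1"
      using \<alpha>_pos \<alpha>_less_1 by (simp add: power_less_one_iff del: power_Suc)
    then have "R * (1 - \<alpha> ^ Suc k) > 0"
      using R_pos by simp
    then show ?thesis
      using erosion_iterate[of "Suc k" x] x centre_in_ball by blast
  qed
  have "(\<lambda>k. \<alpha> ^ Suc k * norm x) \<longlonglongrightarrow> 0 * norm x"
    using \<alpha>_pos \<alpha>_less_1 by (intro tendsto_mult tendsto_const LIMSEQ_Suc LIMSEQ_realpow_zero) auto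
  then have "(\<lambda>k. norm (\<alpha> ^ Suc k *\<^sub>R (L ^^ Suc k) x)) \<longlonglongrightarrow> 0"
    using \<alpha>_pos by (simp add: norm_L_funpow orthogonal_transformation_norm[OF orth])
  then have "(\<lambda>k. \<alpha> ^ Suc k *\<^sub>R (L ^^ Suc k) x) \<longlonglongrightarrow> 0"
    by (rule tendsto_norm_zero_cancel)
  then show ?thesis
    using closed_sequentially[OF closed_X, of "\<lambda>k. \<alpha> ^ Suc k *\<^sub>R (L ^^ Suc k) x"] mem by blast
qed

lemma L_funpow_0: "(L ^^ k) 0 = 0"
  using norm_L_funpow[of k 0] by simp

lemma cball_subset_X: "cball 0 R \<subseteq> X"
proof -
  have "ball 0 R \<subseteq> X"
  proof
    fix y :: 'a assume "y \<in> ball 0 R"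
    then have y: "norm y < R"
      by simp
    have "(\<lambda>k. R * (1 - \<alpha> ^ Suc k)) \<longlonglongrightarrow> R * (1 - 0)"
      using \<alpha>_pos \<alpha>_less_1
      by (intro tendsto_mult tendsto_diff tendsto_const LIMSEQ_Suc LIMSEQ_realpow_zero) auto
    then have "\<forall>\<^sub>F k in sequentially. norm y < R * (1 - \<alpha> ^ Suc k)"
      using y by (intro order_tendstoD) auto
    then obtain k where "norm y < R * (1 - \<alpha> ^ Suc k)"
      by (metis (mono_tags, lifting) eventually_sequentially order_refl)
    moreover have "ball 0 (R * (1 - \<alpha> ^ Suc k)) \<subseteq> X"
      using erosion_iterate[of "Suc k" 0] zero_in_X L_funpow_0[of "Suc k"] by simp
    ultimately show "y \<in> X"
      by (auto simp: subset_iff)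
  qed
  then have "closure (ball 0 R) \<subseteq> X"
    using closed_X by (rule closure_minimal)
  then show ?thesis
    using R_pos by simp
qed

section \<open>Separating exterior points, and convexity\<close>

text \<open>
  The point \<open>Y\<close> is at distance less than \<open>R (1 - \<alpha>^k)\<close> from \<open>\<alpha>^k L^k z\<close> and at least that distance
  from \<open>\<alpha>^k L^k x\<close> for every \<open>x \<in> X\<close>. In the squares of these distances \<open>z\<close> and \<open>x\<close> enter linearly,
  through the inner product with the pulled-back vector, up to a term of order \<open>\<alpha>^(2 k)\<close>. After
  division by \<open>2 \<alpha>^k\<close> the error is of order \<open>\<alpha>^k\<close>, and \<open>norm Y \<ge> R\<close> yields the bound \<open>R\<^sup>2\<close>.
\<close>

lemma exterior_witness:
  assumes "z \<notin> X" "k > 0"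
  obtains Y where "Y \<notin> X" "R \<le> norm Y" "norm Y \<le> R + \<alpha> ^ k * norm z"
    "R\<^sup>2 - \<alpha> ^ k * (R\<^sup>2 / 2) \<le> (M ^^ k) Y \<bullet> z"
    "\<And>x. x \<in> X \<Longrightarrow> (M ^^ k) Y \<bullet> x \<le> (M ^^ k) Y \<bullet> z + \<alpha> ^ k * ((norm x)\<^sup>2 / 2)"
proof -
  define a where "a = \<alpha> ^ k"
  have a: "0 < a" "a < 1"
    unfolding a_def using \<alpha>_pos \<alpha>_less_1 assms by (auto simp: power_less_one_iff)
  obtain Y where Y: "Y \<notin> X" "norm (Y - a *\<^sub>R (L ^^ k) z) < R * (1 - a)"
    using erosion_iterate[OF \<open>k > 0\<close>, of z] \<open>z \<notin> X\<close> unfolding a_def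
    by (metis dist_norm dist_commute mem_ball subsetI)
  have outside: "R * (1 - a) \<le> norm (Y - a *\<^sub>R (L ^^ k) x)" if "x \<in> X" for x
  proof -
    have "Y \<notin> ball (a *\<^sub>R (L ^^ k) x) (R * (1 - a))"
      using erosion_iterate[OF \<open>k > 0\<close>, of x] that Y(1) unfolding a_def by blast
    then show ?thesis
      by (simp add: dist_norm norm_minus_commute)
  qed
  define U where "U = (M ^^ k) Y"
  have expand: "(norm (Y - a *\<^sub>R (L ^^ k) x))\<^sup>2 = (norm Y)\<^sup>2 - 2 * a * (U \<bullet> x) + a\<^sup>2 * (norm x)\<^sup>2" for x
    unfolding U_def inner_M_funpow norm_L_funpow[of k x, symmetric] power2_norm_eq_inner
    by (simp add: inner_diff_left inner_diff_right inner_commute power2_eq_square)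
  have lo: "R \<le> norm Y"
  proof (rule ccontr)
    assume "\<not> R \<le> norm Y"
    then have "Y \<in> cball 0 R"
      by simp
    then show False
      using Y(1) cball_subset_X by blast
  qed
  have "norm Y \<le> norm (Y - a *\<^sub>R (L ^^ k) z) + norm (a *\<^sub>R (L ^^ k) z)"
    by (metis diff_add_cancel norm_triangle_ineq)
  also have "\<dots> \<le> R + a * norm z"
    using Y(2) a R_pos by (simp add: norm_L_funpow algebra_simps) (smt (verit) mult_pos_pos)
  finally have hi: "norm Y \<le> R + a * norm z" .
  have sq: "(norm (Y - a *\<^sub>R (L ^^ k) z))\<^sup>2 < (R * (1 - a))\<^sup>2"
    using Y(2) by (intro power_strict_mono) auto
  have "R\<^sup>2 \<le> (norm Y)\<^sup>2"
    using lo R_pos by (intro power_mono) auto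
  then have "2 * a * (R\<^sup>2 - a * (R\<^sup>2 / 2)) \<le> 2 * a * (U \<bullet> z)"
    using sq[unfolded expand] by (simp add: power_mult_distrib power2_diff algebra_simps power2_eq_square)
       (smt (verit) zero_le_square mult_nonneg_nonneg a mult.assoc)
  then have 1: "R\<^sup>2 - a * (R\<^sup>2 / 2) \<le> U \<bullet> z"
    using a by simp
  have 2: "U \<bullet> x \<le> U \<bullet> z + a * ((norm x)\<^sup>2 / 2)" if "x \<in> X" for x
  proof -
    have "(R * (1 - a))\<^sup>2 \<le> (norm (Y - a *\<^sub>R (L ^^ k) x))\<^sup>2"
      using outside[OF that] R_pos a by (intro power_mono) auto
    with sq have "(norm Y)\<^sup>2 - 2 * a * (U \<bullet> z) + a\<^sup>2 * (norm z)\<^sup>2 < (norm Y)\<^sup>2 - 2 * a * (U \<bullet> x) + a\<^sup>2 * (norm x)\<^sup>2"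
      unfolding expand by linarith
    moreover have "0 \<le> a\<^sup>2 * (norm z)\<^sup>2"
      by simp
    ultimately have "2 * a * (U \<bullet> x) \<le> 2 * a * (U \<bullet> z) + a\<^sup>2 * (norm x)\<^sup>2"
      by linarith
    also have "\<dots> = 2 * a * (U \<bullet> z + a * ((norm x)\<^sup>2 / 2))"
      by (simp add: algebra_simps power2_eq_square)
    finally show ?thesis
      using a by simp
  qed
  show thesis
    using that[OF Y(1) lo] hi 1 2 unfolding a_def U_def by blast
qed

text \<open>
  Compactness lets \<open>k\<close> tend to infinity in \<open>exterior_witness\<close>, along a subsequence on which both the
  exterior points and their pull-backs converge. The two limits may differ, because the powers of
  \<open>L\<close> need not converge to the identity.
\<close>

lemma exterior_limit:
  assumes z: "z \<notin> X"
  obtains m :: "nat \<Rightarrow> nat" and Y y u where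
    "\<And>k. Y k \<notin> X" "Y \<longlonglongrightarrow> y" "(\<lambda>k. (M ^^ m k) (Y k)) \<longlonglongrightarrow> u"
    "norm y = R" "norm u = R" "R\<^sup>2 \<le> u \<bullet> z" "\<And>x. x \<in> X \<Longrightarrow> u \<bullet> x \<le> u \<bullet> z"
proof -
  have "\<forall>k. \<exists>Y. Y \<notin> X \<and> R \<le> norm Y \<and> norm Y \<le> R + \<alpha> ^ Suc k * norm z \<and>
    R\<^sup>2 - \<alpha> ^ Suc k * (R\<^sup>2 / 2) \<le> (M ^^ Suc k) Y \<bullet> z \<and>
    (\<forall>x\<in>X. (M ^^ Suc k) Y \<bullet> x \<le> (M ^^ Suc k) Y \<bullet> z + \<alpha> ^ Suc k * ((norm x)\<^sup>2 / 2))"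
    using exterior_witness[OF z zero_less_Suc] by metis
  then obtain W where W: "\<And>k. W k \<notin> X" "\<And>k. R \<le> norm (W k)"
    "\<And>k. norm (W k) \<le> R + \<alpha> ^ Suc k * norm z"
    "\<And>k. R\<^sup>2 - \<alpha> ^ Suc k * (R\<^sup>2 / 2) \<le> (M ^^ Suc k) (W k) \<bullet> z"
    "\<And>k x. x \<in> X \<Longrightarrow> (M ^^ Suc k) (W k) \<bullet> x \<le> (M ^^ Suc k) (W k) \<bullet> z + \<alpha> ^ Suc k * ((norm x)\<^sup>2 / 2)"
    by metis
  let ?C = "cball (0::'a) (R + norm z)"
  have "norm (W k) \<le> R + norm z" for k
  proof -
    have "\<alpha> ^ Suc k * norm z \<le> 1 * norm z"
      using \<alpha>_pos \<alpha>_less_1 by (intro mult_right_mono power_le_one) auto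
    then show ?thesis
      using W(3)[of k] by linarith
  qed
  then have "\<forall>k. (W k, (M ^^ Suc k) (W k)) \<in> ?C \<times> ?C"
    by (simp add: norm_M_funpow del: funpow.simps)
  moreover have "seq_compact (?C \<times> ?C)"
    by (intro compact_imp_seq_compact compact_Times compact_cball)
  ultimately obtain l \<phi> where \<phi>: "strict_mono (\<phi> :: nat \<Rightarrow> nat)"
    and l: "((\<lambda>k. (W k, (M ^^ Suc k) (W k))) \<circ> \<phi>) \<longlonglongrightarrow> l"
    by (metis (no_types, lifting) seq_compactE)
  define Y where "Y = W \<circ> \<phi>"
  \<comment> \<open>Successors, as the witnesses exist only for positive exponents.\<close>
  define m where "m k = Suc (\<phi> k)" for k
  have Y: "Y \<longlonglongrightarrow> fst l" and U: "(\<lambda>k. (M ^^ m k) (Y k)) \<longlonglongrightarrow> snd l"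
    using tendsto_fst[OF l] tendsto_snd[OF l] unfolding Y_def m_def by (simp_all add: o_def)
  have "(\<lambda>k. \<alpha> ^ Suc k) \<longlonglongrightarrow> 0"
    using \<alpha>_pos \<alpha>_less_1 by (intro LIMSEQ_Suc LIMSEQ_realpow_zero) auto
  then have pow: "(\<lambda>k. \<alpha> ^ m k) \<longlonglongrightarrow> 0"
    using LIMSEQ_subseq_LIMSEQ[OF _ \<phi>] unfolding m_def by (fastforce simp: o_def)
  have nY: "norm (fst l) = R"
  proof (rule antisym)
    show "R \<le> norm (fst l)"
      by (rule tendsto_lowerbound[OF tendsto_norm[OF Y]]) (auto simp: Y_def W)
    have "(\<lambda>k. R + \<alpha> ^ m k * norm z) \<longlonglongrightarrow> R + 0 * norm z"
      by (intro tendsto_intros pow)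
    then show "norm (fst l) \<le> R"
      using tendsto_le[OF _ _ tendsto_norm[OF Y], of "\<lambda>k. R + \<alpha> ^ m k * norm z" R] W(3)
      by (simp add: Y_def m_def)
  qed
  have "(\<lambda>k. norm ((M ^^ m k) (Y k))) \<longlonglongrightarrow> norm (fst l)"
    unfolding norm_M_funpow by (intro tendsto_norm Y)
  then have nU: "norm (snd l) = R"
    using LIMSEQ_unique[OF tendsto_norm[OF U]] nY by simp
  have "(\<lambda>k. R\<^sup>2 - \<alpha> ^ m k * (R\<^sup>2 / 2)) \<longlonglongrightarrow> R\<^sup>2 - 0 * (R\<^sup>2 / 2)"
    by (intro tendsto_intros pow)
  then have z1: "R\<^sup>2 \<le> snd l \<bullet> z"
    using tendsto_le[OF _ tendsto_inner[OF U tendsto_const]] W(4)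
    by (simp add: Y_def m_def del: funpow.simps power_Suc)
  have x1: "snd l \<bullet> x \<le> snd l \<bullet> z" if "x \<in> X" for x
  proof -
    have "(\<lambda>k. (M ^^ m k) (Y k) \<bullet> z + \<alpha> ^ m k * ((norm x)\<^sup>2 / 2)) \<longlonglongrightarrow> snd l \<bullet> z + 0 * ((norm x)\<^sup>2 / 2)"
      by (intro tendsto_intros U pow)
    then show ?thesis
      using tendsto_le[OF _ _ tendsto_inner[OF U tendsto_const[of x]]] W(5)[OF that]
      by (simp add: Y_def m_def del: funpow.simps power_Suc)
  qed
  show thesis
    by (rule that[OF _ Y U nY nU z1 x1]) (auto simp: Y_def W)
qed

text \<open>
  Every point outside \<open>X\<close> is weakly separated from \<open>X\<close>, so it is not interior to the convex hull.
  Hence \<open>X\<close> contains the interior of its hull, which is dense in the hull as \<open>X\<close> contains a ball.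
\<close>

lemma convex_X: "convex X"
proof -
  have "interior (convex hull X) \<subseteq> X"
  proof
    fix z assume z: "z \<in> interior (convex hull X)"
    show "z \<in> X"
    proof (rule ccontr)
      assume "z \<notin> X"
      then obtain u where u: "norm u = R" "\<And>x. x \<in> X \<Longrightarrow> u \<bullet> x \<le> u \<bullet> z"
        using exterior_limit by metis
      have "u \<noteq> 0"
        using u(1) R_pos by auto
      have "convex hull X \<subseteq> {x. u \<bullet> x \<le> u \<bullet> z}"
        using u(2) by (intro hull_minimal convex_halfspace_le) auto
      then have "z \<in> interior {x. u \<bullet> x \<le> u \<bullet> z}"
        using z interior_mono by blast
      then show False
        using \<open>u \<noteq> 0\<close> by simp
    qed
  qed
  then have "closure (interior (convex hull X)) \<subseteq> X"
    using closed_X by (rule closure_minimal)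
  moreover have "interior (convex hull X) \<noteq> {}"
  proof -
    have "0 \<in> interior X"
      using cball_subset_X R_pos mem_interior_cball by blast
    then show ?thesis
      using interior_mono[OF hull_subset[of X convex]] by blast
  qed
  ultimately have "closure (convex hull X) \<subseteq> X"
    by (simp add: convex_closure_interior)
  then have "convex hull X = X"
    using closure_subset[of "convex hull X"] hull_subset[of X convex] by blast
  then show ?thesis
    by (metis convex_convex_hull)
qed

section \<open>Contact points of the central ball\<close>

text \<open>
  The points of the ball of radius \<open>R\<close> about the origin at which the tangent hyperplane of the ball
  supports \<open>X\<close>.
\<close>

definition contact_points :: "'a set" where
  "contact_points = {u. norm u = R \<and> (\<forall>x\<in>X. u \<bullet> x \<le> R\<^sup>2)}"

lemma compact_contact_points: "compact contact_points"
proof -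
  have "contact_points = sphere 0 R \<inter> (\<Inter>x\<in>X. {u. x \<bullet> u \<le> R\<^sup>2})"
    unfolding contact_points_def by (auto simp: inner_commute)
  then show ?thesis
    by (auto intro!: compact_Int_closed closed_INT closed_halfspace_le)
qed

lemma frontier_inball_contact_point:
  assumes "y \<in> frontier X" "norm y = R"
  shows "y \<in> contact_points"
proof -
  have "supporting_halfspace_at X {x. (y - 0) \<bullet> x \<le> (y - 0) \<bullet> y} y"
    by (rule regular_point_touching_ball[OF convex_X closed_X cball_subset_X])
      (use assms R_pos in auto)
  then have "\<forall>x\<in>X. y \<bullet> x \<le> y \<bullet> y"
    unfolding supporting_halfspace_at_def by auto
  then show ?thesis
    unfolding contact_points_def using assms(2) by (simp flip: power2_norm_eq_inner)
qed

text \<open>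
  If \<open>X\<close> lies in the half-space \<open>v \<bullet> x \<le> R\<^sup>2\<close>, its erosion lies in \<open>v \<bullet> x \<le> R\<^sup>2 - r R = \<alpha> R\<^sup>2\<close>.
  Since the erosion is the image of \<open>X\<close> under \<open>\<alpha> L\<close>, this is the half-space condition for \<open>M v\<close>.
\<close>

lemma contact_points_invariant:
  assumes "v \<in> contact_points"
  shows "M v \<in> contact_points"
proof -
  have v: "norm v = R" "\<And>x. x \<in> X \<Longrightarrow> v \<bullet> x \<le> R\<^sup>2"
    using assms unfolding contact_points_def by auto
  have "M v \<bullet> x \<le> R\<^sup>2" if "x \<in> X" for x
  proof -
    have "closure (ball (\<alpha> *\<^sub>R L x) r) \<subseteq> X"
      using that closed_X unfolding erosion_iff[of x] by (rule closure_minimal)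
    then have "\<alpha> *\<^sub>R L x + (r / R) *\<^sub>R v \<in> X"
      using v(1) r_pos R_pos by (auto simp: dist_norm subset_iff)
    then have "v \<bullet> (\<alpha> *\<^sub>R L x + (r / R) *\<^sub>R v) \<le> R\<^sup>2"
      by (rule v(2))
    moreover have "v \<bullet> v = R\<^sup>2"
      using v(1) by (simp flip: power2_norm_eq_inner)
    ultimately have "\<alpha> * (v \<bullet> L x) + r * R \<le> R * R"
      using R_pos by (simp add: inner_add_right power2_eq_square)
    also have "R * R = \<alpha> * R\<^sup>2 + r * R"
      using arg_cong[OF R_fixed, of "\<lambda>t. t * R"] by (simp add: algebra_simps power2_eq_square)
    finally have "v \<bullet> L x \<le> R\<^sup>2"
      using \<alpha>_pos by simp
    then show ?thesis
      using inner_M_funpow[of 1 v x] by simp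
  qed
  then show ?thesis
    using norm_M_funpow[of 1 v] v(1) unfolding contact_points_def by simp
qed

text \<open>
  The limit \<open>y\<close> of exterior points with norm \<open>R\<close> is a contact point, and so is its whole orbit under
  \<open>M\<close>. As \<open>M\<close> is an isometry, the orbit approaches the pulled-back exterior points and has the same
  limit \<open>u\<close>.
\<close>

lemma exterior_normal:
  assumes "z \<notin> X"
  obtains u where "u \<in> contact_points" "R\<^sup>2 \<le> u \<bullet> z"
proof -
  obtain m :: "nat \<Rightarrow> nat" and Y y u where
    Y: "\<And>k. Y k \<notin> X" "Y \<longlonglongrightarrow> y" and U: "(\<lambda>k. (M ^^ m k) (Y k)) \<longlonglongrightarrow> u"
    and y: "norm y = R" and u: "R\<^sup>2 \<le> u \<bullet> z"
    using exterior_limit[OF assms] by metis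
  have "y \<in> closure (- X)"
    using Y by (auto simp: closure_sequential)
  moreover have "y \<in> X"
    using y cball_subset_X by auto
  ultimately have "y \<in> frontier X"
    using closure_subset by (auto simp: frontier_closures)
  then have y_contact: "y \<in> contact_points"
    using y frontier_inball_contact_point by blast
  have orbit: "(M ^^ k) y \<in> contact_points" for k
    by (induction k) (simp_all add: y_contact contact_points_invariant)
  have "(\<lambda>k. norm (Y k - y)) \<longlonglongrightarrow> 0"
    using Y(2) by (simp add: LIM_zero tendsto_norm_zero)
  then have "(\<lambda>k. norm ((M ^^ m k) (Y k) - (M ^^ m k) y)) \<longlonglongrightarrow> 0"
    unfolding M_funpow_diff[symmetric] norm_M_funpow .
  then have "(\<lambda>k. (M ^^ m k) (Y k) - (M ^^ m k) y) \<longlonglongrightarrow> 0"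
    by (rule tendsto_norm_zero_cancel)
  from tendsto_diff[OF U this] have "(\<lambda>k. (M ^^ m k) y) \<longlonglongrightarrow> u"
    by simp
  then have "u \<in> contact_points"
    using closed_sequentially[OF compact_imp_closed[OF compact_contact_points], of "\<lambda>k. (M ^^ m k) y"] orbit by blast
  then show thesis
    using that u by blast
qed

text \<open>
  Approach \<open>q\<close> by exterior points; compactness of the set of contact points provides a limit, and
  \<open>q \<in> X\<close> turns the inequality of \<open>exterior_normal\<close> into an equality.
\<close>

lemma frontier_normal:
  assumes "q \<in> frontier X"
  obtains u where "u \<in> contact_points" "u \<bullet> q = R\<^sup>2"
proof -
  have "q \<in> closure (- X)"
    using assms by (simp add: frontier_closures)
  then obtain Z where "\<forall>k. Z k \<in> - X" and Z_lim: "Z \<longlonglongrightarrow> q"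
    unfolding closure_sequential by blast
  then have Z: "Z k \<notin> X" for k
    by blast
  have "\<exists>u. u \<in> contact_points \<and> R\<^sup>2 \<le> u \<bullet> Z k" for k
    by (rule exterior_normal[OF Z]) blast
  then obtain u where u: "\<forall>k. u k \<in> contact_points" "\<And>k. R\<^sup>2 \<le> u k \<bullet> Z k"
    by metis
  obtain v \<phi> where v: "v \<in> contact_points" "strict_mono (\<phi> :: nat \<Rightarrow> nat)" "(u \<circ> \<phi>) \<longlonglongrightarrow> v"
    by (rule seq_compactE[OF compact_imp_seq_compact[OF compact_contact_points] u(1)])
  have "(\<lambda>k. (u \<circ> \<phi>) k \<bullet> (Z \<circ> \<phi>) k) \<longlonglongrightarrow> v \<bullet> q"
    using v(3) LIMSEQ_subseq_LIMSEQ[OF Z_lim v(2)] by (rule tendsto_inner)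
  then have "R\<^sup>2 \<le> v \<bullet> q"
    by (rule tendsto_lowerbound) (simp_all add: u(2))
  moreover have "q \<in> X"
    using assms closed_X frontier_subset_closed by blast
  then have "v \<bullet> q \<le> R\<^sup>2"
    using v(1) unfolding contact_points_def by simp
  ultimately show thesis
    by (intro that[OF v(1)] antisym)
qed

end

section \<open>The characterisation of resilient sets\<close>

text \<open>
  After translation of the fixed point to the origin, the preceding results give convexity, the ball,
  and at each boundary point a supporting half-space tangent to the ball; at a regular point there
  is no other.
\<close>

lemma inscribed_ball_if_resilient:
  fixes X :: "'a::euclidean_space set"
  assumes "r > 0" "bounded X" "X \<noteq> {}" "resilient r X"
  obtains c s where "convex_body X" "s > r" "inscribed_ball X c s"
proof -
  obtain \<sigma> where \<sigma>: "similarity \<sigma>" and e: "erosion r X = \<sigma> ` X"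
    using assms unfolding resilient_def by blast
  then obtain \<alpha> where \<alpha>: "\<alpha> > 0" and d: "\<And>x y. dist (\<sigma> x) (\<sigma> y) = \<alpha> * dist x y"
    unfolding similarity_def by blast
  have \<alpha>1: "\<alpha> < 1"
    using resilient_ratio_less_1[OF assms(2,3,1) \<alpha> d e] .
  have cl: "closed X"
    using resilient_closed[OF \<sigma> e assms(1)] .
  have "\<exists>!x. \<sigma> x = x"
    using \<alpha> \<alpha>1 d by (intro banach_fix_type[of \<alpha>]) simp_all
  then obtain c where c: "\<sigma> c = c"
    by blast
  define L where "L x = (1 / \<alpha>) *\<^sub>R (\<sigma> (c + x) - c)" for x
  have \<sigma>L: "\<sigma> (c + x) = c + \<alpha> *\<^sub>R L x" for x
    unfolding L_def using \<alpha> by simp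
  define X0 where "X0 = {x. c + x \<in> X}"
  have X: "X = (+) c ` X0"
  proof
    show "X \<subseteq> (+) c ` X0"
    proof
      fix x assume "x \<in> X"
      then have "x = c + (x - c)" "x - c \<in> X0"
        unfolding X0_def by simp_all
      then show "x \<in> (+) c ` X0"
        by (rule image_eqI)
    qed
  qed (auto simp: X0_def)
  have inj: "inj \<sigma>"
    by (rule injI) (metis \<alpha> d dist_eq_0_iff mult_eq_0_iff less_irrefl)
  interpret self_eroding X0 \<alpha> r L
  proof
    show "closed X0"
      using closed_vimage[OF cl, of "(+) c"] unfolding X0_def
      by (simp add: vimage_def continuous_intros)
    show "X0 \<noteq> {}"
      using assms(3) X by blast
    show "orthogonal_transformation L"
      unfolding orthogonal_transformation_isometry
    proof (intro conjI allI)
      show "L 0 = 0"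
        unfolding L_def using c by simp
      fix x y
      have "\<alpha> * dist (L x) (L y) = dist (\<sigma> (c + x)) (\<sigma> (c + y))"
        unfolding \<sigma>L using \<alpha> by (simp add: dist_norm flip: scaleR_diff_right)
      then show "dist (L x) (L y) = dist x y"
        using d \<alpha> by simp
    qed
    fix x
    have "c + x \<in> X \<longleftrightarrow> \<sigma> (c + x) \<in> erosion r X"
      unfolding e using inj by (simp add: inj_image_mem_iff)
    also have "\<dots> \<longleftrightarrow> ball (c + \<alpha> *\<^sub>R L x) r \<subseteq> X"
      unfolding erosion_eq[OF assms(1)] \<sigma>L by simp
    also have "ball (c + \<alpha> *\<^sub>R L x) r = (+) c ` ball (\<alpha> *\<^sub>R L x) r"
      by (rule ball_translation)
    finally show "x \<in> X0 \<longleftrightarrow> ball (\<alpha> *\<^sub>R L x) r \<subseteq> X0"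
      by (simp only: X0_def image_subset_iff subset_eq[of _ "Collect _"] mem_Collect_eq)
  qed (use \<alpha> \<alpha>1 assms in auto)
  have "convex X"
    unfolding X using convex_X by (rule convex_translation)
  then have 1: "convex_body X"
    using cl unfolding convex_body_def by simp
  have "cball c R = (+) c ` cball 0 R"
    by (simp flip: cball_translation)
  then have sub: "cball c R \<subseteq> X"
    unfolding X using cball_subset_X by blast
  have "cball c R \<inter> P \<noteq> {}" if P: "regular_supporting_hyperplane X P" for P
  proof -
    obtain H q where H: "P = frontier H" "regular_point X q" "supporting_halfspace_at X H q"
      using P unfolding regular_supporting_hyperplane_def regular_supporting_halfspace_def by blast
    have q: "q \<in> frontier X"
      using H(2) unfolding regular_point_def by simp
    then have "q - c \<in> frontier X0"
      unfolding X by (auto simp: frontier_translation)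
    then obtain u where u: "u \<in> contact_points" "u \<bullet> (q - c) = R\<^sup>2"
      using frontier_normal by blast
    then have un: "norm u = R" "u \<noteq> 0"
      using R_pos unfolding contact_points_def by auto
    let ?H = "{x. u \<bullet> x \<le> u \<bullet> q}"
    have "X \<subseteq> ?H"
    proof
      fix x assume "x \<in> X"
      then have "x - c \<in> X0"
        unfolding X0_def by simp
      then have "u \<bullet> (x - c) \<le> u \<bullet> (q - c)"
        using u unfolding contact_points_def by auto
      then show "x \<in> ?H"
        by (simp add: inner_diff_right)
    qed
    moreover have "q \<in> frontier ?H"
      using un by (subst frontier_halfspace_le) auto
    moreover have "closed_halfspace ?H"
      unfolding closed_halfspace_def using un by blast
    ultimately have "supporting_halfspace_at X ?H q"
      unfolding supporting_halfspace_at_def using q by blast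
    then have "H = ?H"
      using H(2,3) unfolding regular_point_def by blast
    then have "P = {x. u \<bullet> x = u \<bullet> q}"
      using H(1) un by (simp add: frontier_halfspace_le)
    moreover have "u \<bullet> (c + u) = u \<bullet> q"
      using u(2) un(1) by (simp add: inner_simps flip: power2_norm_eq_inner)
    ultimately have "c + u \<in> P"
      by blast
    moreover have "c + u \<in> cball c R"
      using un by (simp add: dist_norm)
    ultimately show ?thesis
      by blast
  qed
  with sub have "inscribed_ball X c R"
    unfolding inscribed_ball_def by blast
  then show thesis
    using that 1 r_less_R by blast
qed

theorem theorem1p2:
  fixes r :: real and X :: "(real ^ 'n) set"
  assumes "r > 0" and "bounded X" and "X \<noteq> {}"
  shows "resilient r X \<longleftrightarrow> convex_body X \<and> (\<exists>c s. s > r \<and> inscribed_ball X c s)"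
  using assms resilient_if_inscribed_ball inscribed_ball_if_resilient by metis

end
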